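(* Let $n\in\mathbb{N}$, $n\ge 1$, and let $D_1,\dots,D_n$ be oriented graphs satisfying $\operatorname{inv}(D_i)\leq 2$ for all $i$. Then \[ \operatorname{inv}([D_1,\dots,D_n])=\sum_{i=1}^n\operatorname{inv}(D_i). \]
   Context: An oriented graph is a finite simple oriented graph: no loops and at most one arc between any two vertices. For an oriented graph $D$ and $X\subseteq V(D)$, the inversion of $X$ in $D$ is the oriented graph obtained by reversing the orientation of every arc with both ends in $X$. A family $X_1,\dots,X_m$ of subsets of $V(D)$ is a decycling family for $D$ if successively inverting all of $X_1,\dots,X_m$ (the order does not matter) yields an oriented graph with no directed cycle. The inversion number $\operatorname{inv}(D)$ is the smallest integer $m\ge 0$ for which there is a decycling family of $m$ sets for $D$. The $n$-join $[D_1,\dots,D_n]$ is the disjoint union of $D_1,\dots,D_n$ together with an arc from every vertex of $D_a$ to every vertex of $D_b$ for all $a<b$. *)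

theory Defs
  imports "Graph_Theory.Graph_Theory"
begin

text \<open>Oriented graphs are digraphs whose arcs are pairs of vertices; asymmetry of the arc
  relation excludes opposite arcs. The null graph is allowed.\<close>

locale oriented_graph = pair_digraph +
  assumes asym_arcs: "(u, v) \<in> parcs G \<Longrightarrow> (v, u) \<notin> parcs G"

definition invert :: "'a set \<Rightarrow> 'a pair_pre_digraph \<Rightarrow> 'a pair_pre_digraph" where
  "invert X D = \<lparr> pverts = pverts D,
     parcs = {(u, v). (u, v) \<in> parcs D \<and> \<not> (u \<in> X \<and> v \<in> X)}
           \<union> {(v, u) | u v. (u, v) \<in> parcs D \<and> u \<in> X \<and> v \<in> X} \<rparr>"

text \<open>Families are lists, so that repetitions are allowed and the number of sets is the
  length of the list.\<close>

definition decycling_family :: "'a pair_pre_digraph \<Rightarrow> 'a set list \<Rightarrow> bool" where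
  "decycling_family D Xs \<longleftrightarrow>
     (\<forall>X \<in> set Xs. X \<subseteq> pverts D) \<and>
     \<not> (\<exists>p. pre_digraph.cycle (with_proj (fold invert Xs D)) p)"

text \<open>The minimum is attained for every oriented graph, see \<open>decycling_family_exists\<close> below.\<close>

definition inversion_number :: "'a pair_pre_digraph \<Rightarrow> nat" where
  "inversion_number D = (LEAST m. \<exists>Xs. length Xs = m \<and> decycling_family D Xs)"

text \<open>The vertex \<open>v\<close> of the \<open>i\<close>-th graph becomes \<open>(i, v)\<close>, which makes the
  union disjoint.\<close>

definition njoin :: "nat \<Rightarrow> (nat \<Rightarrow> 'a pair_pre_digraph) \<Rightarrow> (nat \<times> 'a) pair_pre_digraph" where
  "njoin n D = \<lparr> pverts = (SIGMA i:{1..n}. pverts (D i)),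
     parcs = {((i, u), (i, v)) | i u v. i \<in> {1..n} \<and> (u, v) \<in> parcs (D i)}
           \<union> {((a, u), (b, v)) | a b u v. a \<in> {1..n} \<and> b \<in> {1..n} \<and> a < b
                 \<and> u \<in> pverts (D a) \<and> v \<in> pverts (D b)} \<rparr>"

lemma oriented_graphI:
  assumes "finite (pverts D)"
    and "parcs D \<subseteq> pverts D \<times> pverts D"
    and "\<And>u v. (u, v) \<in> parcs D \<Longrightarrow> (v, u) \<notin> parcs D"
  shows "oriented_graph D"
proof
  show "finite (parcs D)"
    using assms(1,2) by (meson finite_SigmaI finite_subset)
  show "\<And>e. e \<in> parcs D \<Longrightarrow> fst e \<noteq> snd e"
    using assms(3) by (metis prod.collapse)
qed (use assms in auto)

lemma oriented_graphD:
  assumes "oriented_graph D"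
  shows "finite (pverts D)" "finite (parcs D)" "parcs D \<subseteq> pverts D \<times> pverts D"
    and "\<And>u v. (u, v) \<in> parcs D \<Longrightarrow> (v, u) \<notin> parcs D"
proof -
  interpret oriented_graph D by fact
  show "finite (pverts D)" "finite (parcs D)"
    by (simp_all add: pair_finite_verts pair_finite_arcs)
  show "parcs D \<subseteq> pverts D \<times> pverts D"
    using in_arcsD1 in_arcsD2 by auto
  show "\<And>u v. (u, v) \<in> parcs D \<Longrightarrow> (v, u) \<notin> parcs D"
    by (rule asym_arcs)
qed

lemma oriented_graph_invert:
  assumes "oriented_graph D"
  shows "oriented_graph (invert X D)"
  using oriented_graphD[OF assms]
  by (intro oriented_graphI) (auto simp: invert_def)

lemma oriented_graph_njoin:
  assumes "\<And>i. i \<in> {1..n} \<Longrightarrow> oriented_graph (D i)"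
  shows "oriented_graph (njoin n D)"
proof -
  have *: "parcs (D i) \<subseteq> pverts (D i) \<times> pverts (D i)"
    "\<And>u v. (u, v) \<in> parcs (D i) \<Longrightarrow> (v, u) \<notin> parcs (D i)"
    "finite (pverts (D i))" if "i \<in> {1..n}" for i
    using oriented_graphD[OF assms[OF that]] by blast+
  show ?thesis
    proof (rule oriented_graphI)
    show "finite (pverts (njoin n D))"
      unfolding njoin_def pair_pre_digraph.simps by (intro finite_SigmaI *(3)) simp
    show "parcs (njoin n D) \<subseteq> pverts (njoin n D) \<times> pverts (njoin n D)"
      using *(1) by (fastforce simp: njoin_def)
    show "\<And>u v. (u, v) \<in> parcs (njoin n D) \<Longrightarrow> (v, u) \<notin> parcs (njoin n D)"
      using *(2) by (auto simp: njoin_def)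
  qed
qed

lemma no_cycle_if_increasing:
  fixes f :: "'a \<Rightarrow> nat"
  assumes "oriented_graph D" and inc: "\<And>u v. (u, v) \<in> parcs D \<Longrightarrow> f u < f v"
  shows "\<not> (\<exists>p. pre_digraph.cycle (with_proj D) p)"
proof
  interpret oriented_graph D by fact
  assume "\<exists>p. pre_digraph.cycle (with_proj D) p"
  then obtain u where "(u, u) \<in> (parcs D)\<^sup>+"
    using reachable1_awalk by (auto simp: cycle_def)
  moreover have "f x < f y" if "(x, y) \<in> (parcs D)\<^sup>+" for x y
    using that by induction (auto dest: inc intro: less_trans)
  ultimately show False by blast
qed

lemma decycling_family_exists:
  assumes "oriented_graph D"
  shows "\<exists>Xs. decycling_family D Xs"
proof -
  obtain f :: "'a \<Rightarrow> nat" where f: "inj_on f (pverts D)"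
    using finite_imp_inj_to_nat_seg[OF oriented_graphD(1)[OF assms]] by blast
  from assms f show ?thesis
  proof (induction "card {(u, v) \<in> parcs D. f v < f u}" arbitrary: D rule: less_induct)
    case less
    note D = oriented_graphD[OF less.prems(1)]
    show ?case
    proof (cases "\<exists>u v. (u, v) \<in> parcs D \<and> f v < f u")
      case False
      have "f u < f v" if "(u, v) \<in> parcs D" for u v
      proof -
        have "u \<noteq> v" "u \<in> pverts D" "v \<in> pverts D" using that D(3,4) by blast+
        then have "f u \<noteq> f v" using less.prems(2) by (auto dest: inj_onD)
        with that False show ?thesis by (meson linorder_neqE_nat)
      qed
      then have "decycling_family D []"
        using no_cycle_if_increasing[OF less.prems(1)] by (auto simp: decycling_family_def)
      then show ?thesis by blast
    next
      case True
      then obtain u v where uv: "(u, v) \<in> parcs D" "f v < f u" by blast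
      let ?D = "invert {u, v} D"
      have arcs: "parcs ?D = insert (v, u) (parcs D - {(u, v)})"
        using uv(1) D(4) by (auto simp: invert_def)
      have pverts: "pverts ?D = pverts D"
        by (simp add: invert_def)
      have "{(x, y) \<in> parcs ?D. f y < f x} = {(x, y) \<in> parcs D. f y < f x} - {(u, v)}"
        using uv(2) by (auto simp: arcs)
      moreover have "finite {(x, y) \<in> parcs D. f y < f x}"
        by (rule finite_subset[OF _ D(2)]) blast
      moreover have "(u, v) \<in> {(x, y) \<in> parcs D. f y < f x}"
        using uv by simp
      ultimately have "card {(x, y) \<in> parcs ?D. f y < f x} < card {(x, y) \<in> parcs D. f y < f x}"
        by (simp only: card_Diff1_less)
      then obtain Xs where Xs: "decycling_family ?D Xs"
        using less.hyps oriented_graph_invert[OF less.prems(1)] less.prems(2) unfolding pverts[symmetric]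
        by blast
      have "decycling_family D ({u, v} # Xs)"
        using Xs uv(1) D(3) by (auto simp: decycling_family_def pverts)
      then show ?thesis by blast
    qed
  qed
qed

end

(* Encode a family of m sets by the Gram matrix M over F_2 of the incidence vectors of the vertices;
   M has rank at most m, and an arc uv is reversed iff M u v = 1. If f orders the inverted join
   acyclically, then M w u = 1 iff f u < f w for u in the last graph D_n and w in an earlier one.
   When inv(D_n) = 2, some two vertices u, v of D_n give a nonsingular 2x2 principal minor: otherwise
   M u v = M u u * M v v on D_n, and one set would suffice. Passing to the Schur complement of this
   minor lowers the rank by 2, and on [D_1,...,D_(n-1)] it changes M only as a function of the
   positions of the vertices relative to u and v. These cut the order into three zones, and the change
   amounts to reversing or swapping the last two, so the Schur complement again orders the join
   acyclically and induction applies. When inv(D_n) = 1, a 1x1 or such a 2x2 minor is available. *)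

theory Submission
  imports Defs "HOL-Library.Z2"
begin

text \<open>Keeps \<open>+\<close> and \<open>*\<close> on \<open>bit\<close> as field operations;
  these rules would turn them into bitwise ones.\<close>

declare add_bit_eq_xor [simp del] mult_bit_eq_and [simp del]

subsection \<open>Matrices of bounded rank\<close>

text \<open>A rank factorisation. The index set is an arbitrary finite set, so that elimination can
  delete any one index.\<close>

definition rank_le :: "nat \<Rightarrow> ('a \<Rightarrow> 'a \<Rightarrow> 'k::field) \<Rightarrow> bool" where
  "rank_le r M \<longleftrightarrow> (\<exists>(I::nat set) f g. finite I \<and> card I \<le> r \<and>
     (\<forall>u v. M u v = (\<Sum>i\<in>I. f i u * g i v)))"

text \<open>The Schur complement of the entry \<open>M a b\<close>, that is, one elimination step
  with pivot \<open>(a, b)\<close>.\<close>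

definition reduce :: "('a \<Rightarrow> 'a \<Rightarrow> 'k::field) \<Rightarrow> 'a \<Rightarrow> 'a \<Rightarrow> 'a \<Rightarrow> 'a \<Rightarrow> 'k" where
  "reduce M a b u v = M u v - M u b / M a b * M a v"

lemma rank_le_reduce:
  fixes M :: "'a \<Rightarrow> 'a \<Rightarrow> 'k::field"
  assumes "rank_le r M" "M a b \<noteq> 0"
  shows "r > 0" "rank_le (r - 1) (reduce M a b)"
proof -
  obtain I :: "nat set" and f g where I: "finite I" "card I \<le> r"
    and M: "\<And>u v. M u v = (\<Sum>i\<in>I. f i u * g i v)"
    using assms(1) unfolding rank_le_def by (elim exE conjE) (rule that; simp)
  obtain i where i: "i \<in> I" "g i b \<noteq> 0"
  proof (rule ccontr)
    assume "\<not> thesis"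
    with that have "\<forall>i\<in>I. f i a * g i b = 0" by auto
    then have "M a b = 0" unfolding M by (rule sum.neutral)
    then show False using assms(2) by simp
  qed
  have "card I > 0" using I(1) i(1) card_gt_0_iff by blast
  then show "r > 0" using I(2) by linarith
  \<comment> \<open>Replacing \<open>f\<close> by \<open>f'\<close> turns the sum into
    \<open>reduce M a b\<close>, whose column \<open>b\<close> vanishes. Hence passing from
    \<open>g\<close> to \<open>g'\<close> does not change it, while the term at \<open>i\<close>
    becomes 0.\<close>
  define f' where "f' j u = f j u - M u b / M a b * f j a" for j u
  define g' where "g' j v = g j v - g i v / g i b * g j b" for j v
  have sum_f': "(\<Sum>j\<in>I. f' j u * g j v) = M u v - M u b / M a b * M a v" for u v
    by (simp add: f'_def M[of u v] M[of a v] sum_distrib_left algebra_simps sum_subtractf)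
  have "M u v - M u b / M a b * M a v = (\<Sum>j\<in>I - {i}. f' j u * g' j v)" for u v
  proof -
    have "(\<Sum>j\<in>I - {i}. f' j u * g' j v) = (\<Sum>j\<in>I. f' j u * g' j v)"
      using I(1) i by (simp add: sum.remove[of I i] g'_def)
    also have "\<dots> = (\<Sum>j\<in>I. f' j u * g j v) - g i v / g i b * (\<Sum>j\<in>I. f' j u * g j b)"
      by (simp add: g'_def sum_distrib_left sum_subtractf algebra_simps)
    also have "\<dots> = M u v - M u b / M a b * M a v"
      using assms(2) by (simp add: sum_f')
    finally show ?thesis by simp
  qed
  moreover have "finite (I - {i})" "card (I - {i}) \<le> r - 1"
    using I i by auto
  ultimately show "rank_le (r - 1) (reduce M a b)"
    unfolding rank_le_def reduce_def[abs_def]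
    by (intro exI[of _ "I - {i}"] exI[of _ f'] exI[of _ g'] conjI allI)
qed

lemma bit_minus_divide [simp]: "x - y = x + y" "x / y = x * y" for x y :: bit
  by simp_all

text \<open>Over F_2 the hypothesis \<open>uv\<close> says that the symmetric minor on
  \<open>u\<close> and \<open>v\<close> has determinant 1, so inverting it just exchanges
  \<open>M u u\<close> and \<open>M v v\<close>. The displayed matrix is the Schur complement of
  this minor, reached by two eliminations.\<close>

lemma rank_le_reduce_pair:
  fixes M :: "'a \<Rightarrow> 'a \<Rightarrow> bit"
  assumes M: "rank_le r M" "\<And>x y. M x y = M y x" and uv: "M u v \<noteq> M u u * M v v"
  shows "r \<ge> 2"
    "rank_le (r - 2) (\<lambda>x y. M x y + (M v v * M x u * M y u
       + M u v * (M x u * M y v + M x v * M y u) + M u u * M x v * M y v))"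
proof -
  let ?N = "\<lambda>x y. M x y + (M v v * M x u * M y u
       + M u v * (M x u * M y v + M x v * M y u) + M u u * M x v * M y v)"
  have two: "r \<ge> 2 \<and> rank_le (r - 2) ?N"
    if "M a b \<noteq> 0" "reduce M a b c d \<noteq> 0" "reduce (reduce M a b) c d = ?N" for a b c d
  proof -
    note 1 = rank_le_reduce[of r M a b, OF M(1) that(1)]
    note 2 = rank_le_reduce[of "r - 1" "reduce M a b" c d, OF 1(2) that(2)]
    have "r - 1 - 1 = r - 2" by simp
    with 2(2) have "rank_le (r - 2) ?N" by (simp only: that(3))
    moreover have "r \<ge> 2" using 1(1) 2(1) by linarith
    ultimately show ?thesis by (rule conjI[rotated])
  qed
  have comm: "M v u = M u v" "M u y = M y u" "M v y = M y v" for y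
    by (rule M(2))+
  \<comment> \<open>The first pivot is a nonzero diagonal entry if there is one; otherwise the
    pivots are \<open>(u, v)\<close> and \<open>(v, u)\<close>.\<close>
  consider "M u u = 1" | "M u u = 0" "M v v = 1" | "M u u = 0" "M v v = 0" "M u v = 1"
    using uv by (cases "M u u"; cases "M v v"; cases "M u v") auto
  then have *: "r \<ge> 2 \<and> rank_le (r - 2) ?N"
  proof cases
    case 1
    have v: "M v v = 1 + M u v" using 1 uv by (cases "M u v"; cases "M v v") auto
    have "reduce M u u v v \<noteq> 0"
      unfolding reduce_def v 1 comm(1) by (cases "M u v") simp_all
    moreover have "reduce (reduce M u u) v v x y = ?N x y" for x y
      unfolding reduce_def v 1 comm(1) comm(2)[of y] comm(3)[of y]
      by (cases "M u v"; cases "M x u"; cases "M x v"; cases "M y u"; cases "M y v") simp_all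
    ultimately show ?thesis using 1 by (intro two[of u u v v] ext) simp_all
  next
    case 2
    have "reduce M v v u u \<noteq> 0"
      using uv unfolding reduce_def 2 comm(1) by (cases "M u v") simp_all
    moreover have "reduce (reduce M v v) u u x y = ?N x y" for x y
      using uv unfolding reduce_def 2 comm(1) comm(2)[of y] comm(3)[of y]
      by (cases "M u v"; cases "M x u"; cases "M x v"; cases "M y u"; cases "M y v") simp_all
    ultimately show ?thesis using 2 by (intro two[of v v u u] ext) simp_all
  next
    case 3
    have "reduce M u v v u \<noteq> 0"
      unfolding reduce_def 3 comm(1) by simp
    moreover have "reduce (reduce M u v) v u x y = ?N x y" for x y
      unfolding reduce_def 3 comm(1) comm(2)[of y] comm(3)[of y]
      by (cases "M x u"; cases "M x v"; cases "M y u"; cases "M y v") simp_all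
    ultimately show ?thesis using 3 by (intro two[of u v v u] ext) simp_all
  qed
  show "r \<ge> 2" by (rule conjunct1[OF *])
  show "rank_le (r - 2) ?N" by (rule conjunct2[OF *])
qed

subsection \<open>Gram matrices of decycling families\<close>

definition gram :: "'a set list \<Rightarrow> 'a \<Rightarrow> 'a \<Rightarrow> bit" where
  "gram Xs u v = (\<Sum>X\<leftarrow>Xs. of_bool (u \<in> X) * of_bool (v \<in> X))"

text \<open>If \<open>f\<close> orders the arcs \<open>A\<close> by \<open>M\<close>, then reversing the arcs with \<open>M u v = 1\<close> makes all arcs
  increase along \<open>f\<close>. Non-adjacent vertices may be tied.\<close>

definition ordered_by :: "('a \<times> 'a) set \<Rightarrow> ('a \<Rightarrow> 'a \<Rightarrow> bit) \<Rightarrow> ('a \<Rightarrow> nat) \<Rightarrow> bool" where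
  "ordered_by A M f \<longleftrightarrow> (\<forall>(u, v) \<in> A. f u \<noteq> f v \<and> M u v = of_bool (f v < f u))"

lemma gram_Nil [simp]: "gram [] u v = 0"
  and gram_Cons [simp]: "gram (X # Xs) u v = of_bool (u \<in> X) * of_bool (v \<in> X) + gram Xs u v"
  and gram_append: "gram (Xs @ Ys) u v = gram Xs u v + gram Ys u v"
  by (simp_all add: gram_def)

lemma gram_commute: "gram Xs u v = gram Xs v u"
  by (induction Xs) (simp_all add: mult.commute)

lemma rank_le_gram: "rank_le (length Xs) (gram Xs)"
proof -
  have "gram Xs u v = (\<Sum>i\<in>{..<length Xs}. of_bool (u \<in> Xs ! i) * of_bool (v \<in> Xs ! i))" for u v
    by (simp add: gram_def sum_list_sum_nth atLeast0LessThan)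
  then show ?thesis unfolding rank_le_def
    by (intro exI[of _ "{..<length Xs}"] exI[of _ "\<lambda>i u. of_bool (u \<in> Xs ! i)"] conjI allI) simp_all
qed

section \<open>Inversions, acyclicity and orders\<close>

lemma pverts_fold_invert [simp]: "pverts (fold invert Xs D) = pverts D"
  by (induction Xs arbitrary: D) (simp_all add: invert_def)

lemma oriented_graph_fold_invert: "oriented_graph D \<Longrightarrow> oriented_graph (fold invert Xs D)"
  by (induction Xs arbitrary: D) (simp_all add: oriented_graph_invert)

lemma parcs_invert:
  "(u, v) \<in> parcs (invert X D) \<longleftrightarrow> (if u \<in> X \<and> v \<in> X then (v, u) \<in> parcs D else (u, v) \<in> parcs D)"
  by (auto simp: invert_def)

text \<open>Only the parity of the number of sets containing both ends matters.\<close>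

lemma parcs_fold_invert:
  "(u, v) \<in> parcs (fold invert Xs D) \<longleftrightarrow>
     (if gram Xs u v = 1 then (v, u) \<in> parcs D else (u, v) \<in> parcs D)"
proof (induction Xs arbitrary: D)
  case (Cons X Xs)
  show ?case
    by (cases "gram Xs u v") (auto simp: Cons parcs_invert)
qed simp

lemma acyclic_if_no_cycle:
  assumes "oriented_graph D" "\<not> (\<exists>p. pre_digraph.cycle (with_proj D) p)"
  shows "acyclic (parcs D)"
proof -
  interpret oriented_graph D by fact
  show ?thesis
  proof (rule acyclicI, rule allI, rule notI)
    fix x assume "(x, x) \<in> (parcs D)\<^sup>+"
    then obtain p where "awalk x p x" "p \<noteq> []"
      using reachable1_awalk[of x x] by auto
    then have "closed_w p" by (auto simp: closed_w_def)
    then show False using closed_w_imp_cycle assms(2) by blast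
  qed
qed

lemma acyclic_imp_increasing:
  assumes "finite A" "acyclic A"
  obtains f :: "'a \<Rightarrow> nat" where "\<And>u v. (u, v) \<in> A \<Longrightarrow> f u < f v"
proof
  fix u v assume uv: "(u, v) \<in> A"
  \<comment> \<open>The increasing function counts strict predecessors; acyclicity makes the
    inclusion strict, since \<open>u\<close> precedes \<open>v\<close> but not itself.\<close>
  show "card {w. (w, u) \<in> A\<^sup>+} < card {w. (w, v) \<in> A\<^sup>+}"
  proof (rule psubset_card_mono)
    have "{w. (w, v) \<in> A\<^sup>+} \<subseteq> fst ` A\<^sup>+"
      by (auto intro: image_eqI[where x = "(_, v)"])
    moreover have "finite (fst ` A\<^sup>+)"
      using assms(1) by (simp add: finite_trancl)
    ultimately show "finite {w. (w, v) \<in> A\<^sup>+}"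
      by (rule finite_subset)
    have "(u, v) \<in> A\<^sup>+" "(u, u) \<notin> A\<^sup>+"
      using uv assms(2) by (simp_all add: acyclic_def r_into_trancl)
    moreover have "(w, v) \<in> A\<^sup>+" if "(w, u) \<in> A\<^sup>+" for w
      using that uv by (rule trancl_into_trancl)
    ultimately show "{w. (w, u) \<in> A\<^sup>+} \<subset> {w. (w, v) \<in> A\<^sup>+}"
      by blast
  qed
qed

text \<open>A function increasing along the inverted arcs tells, on each original arc, whether that
  arc was reversed. Both bounds work with this order instead of cycles.\<close>

lemma decycling_family_iff:
  assumes "oriented_graph D"
  shows "decycling_family D Xs \<longleftrightarrow>
    (\<forall>X\<in>set Xs. X \<subseteq> pverts D) \<and> (\<exists>f. ordered_by (parcs D) (gram Xs) f)"
proof -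
  let ?D = "fold invert Xs D"
  have D: "oriented_graph ?D" using assms by (rule oriented_graph_fold_invert)
  have "\<exists>f. ordered_by (parcs D) (gram Xs) f" if acyc: "\<not> (\<exists>p. pre_digraph.cycle (with_proj ?D) p)"
  proof -
    obtain f :: "'a \<Rightarrow> nat" where f: "\<And>u v. (u, v) \<in> parcs ?D \<Longrightarrow> f u < f v"
      using acyclic_imp_increasing[OF oriented_graphD(2)[OF D] acyclic_if_no_cycle[OF D acyc]] by metis
    have "f u \<noteq> f v \<and> gram Xs u v = of_bool (f v < f u)" if "(u, v) \<in> parcs D" for u v
      using f[of u v] f[of v u] that unfolding parcs_fold_invert gram_commute[of Xs v u]
      by (cases "gram Xs u v") auto
    then show ?thesis unfolding ordered_by_def by blast
  qed
  moreover have "\<not> (\<exists>p. pre_digraph.cycle (with_proj ?D) p)" if "ordered_by (parcs D) (gram Xs) f" for f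
  proof (rule no_cycle_if_increasing[OF D])
    fix u v assume "(u, v) \<in> parcs ?D"
    then have "if gram Xs u v = 1 then (v, u) \<in> parcs D else (u, v) \<in> parcs D"
      by (simp add: parcs_fold_invert)
    then show "f u < f v"
      using that gram_commute[of Xs u v] unfolding ordered_by_def
      by (cases "gram Xs u v") (force split: if_splits)+
  qed
  ultimately show ?thesis unfolding decycling_family_def by blast
qed

section \<open>Inversion numbers and their small values\<close>

lemma inversion_number_le: "decycling_family D Xs \<Longrightarrow> inversion_number D \<le> length Xs"
  unfolding inversion_number_def by (rule Least_le) blast

lemma inversion_number_attained:
  assumes "oriented_graph D"
  obtains Xs where "decycling_family D Xs" "length Xs = inversion_number D"
proof -
  have "\<exists>m Xs. length Xs = m \<and> decycling_family D Xs"
    using decycling_family_exists[OF assms] by blast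
  from LeastI_ex[OF this] show ?thesis
    using that unfolding inversion_number_def by blast
qed

lemma inversion_number_eq_0I:
  assumes "oriented_graph D" "ordered_by (parcs D) M f"
    and "\<And>u v. u \<in> pverts D \<Longrightarrow> v \<in> pverts D \<Longrightarrow> M u v = 0"
  shows "inversion_number D = 0"
proof -
  have "ordered_by (parcs D) (gram []) f"
    using assms(2,3) oriented_graphD(3)[OF assms(1)] unfolding ordered_by_def by fastforce
  then have "decycling_family D []"
    using decycling_family_iff[OF assms(1)] by auto
  then show ?thesis using inversion_number_le by fastforce
qed

text \<open>On the vertices, such an \<open>M\<close> is the Gram matrix of the single set where its
  diagonal is 1. Contrapositively, inversion number 2 forces a nonsingular 2x2 principal
  minor.\<close>

lemma inversion_number_le_1I:
  assumes "oriented_graph D" "ordered_by (parcs D) M f"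
    and "\<And>u v. u \<in> pverts D \<Longrightarrow> v \<in> pverts D \<Longrightarrow> M u v = M u u * M v v"
  shows "inversion_number D \<le> 1"
proof -
  let ?X = "{u \<in> pverts D. M u u = 1}"
  have "gram [?X] u v = M u v" if "u \<in> pverts D" "v \<in> pverts D" for u v
    using that assms(3)[OF that] by (cases "M u u"; cases "M v v") auto
  then have "ordered_by (parcs D) (gram [?X]) f"
    using assms(2) oriented_graphD(3)[OF assms(1)] unfolding ordered_by_def by fastforce
  then have "decycling_family D [?X]"
    using decycling_family_iff[OF assms(1)] by auto
  then show ?thesis using inversion_number_le by fastforce
qed

subsection \<open>Reordering by zones\<close>

text \<open>Two thresholds \<open>s \<le> t\<close> cut an order into three zones; a vertex is given by whether it lies
  above \<open>s\<close> and above \<open>t\<close>. The entries \<open>p\<close>, \<open>p + q\<close> and \<open>p + r\<close> are the changes inside the middle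
  zone, between the last two zones, and inside the last zone (since \<open>2q = 0\<close>).\<close>

definition zone_pos :: "bit \<Rightarrow> bit \<Rightarrow> bool \<Rightarrow> bool \<Rightarrow> nat" where
  "zone_pos p q a b = (if b then (if p + q = 1 then 1 else 2)
     else if a then (if p + q = 1 then 2 else 1) else 0)"

definition zone_flip :: "bit \<Rightarrow> bit \<Rightarrow> bool \<Rightarrow> bool \<Rightarrow> bool" where
  "zone_flip p r a b \<longleftrightarrow> (if b then p + r = 1 else a \<and> p = 1)"

lemma zone_pos_eqD:
  "zone_pos p q a b = zone_pos p q a' b' \<Longrightarrow> (b \<longrightarrow> a) \<Longrightarrow> (b' \<longrightarrow> a') \<Longrightarrow> a = a' \<and> b = b'"
  by (auto simp: zone_pos_def split: if_splits)

text \<open>Here \<open>l\<close> stands for \<open>f y < f x\<close>, with unprimed data for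
  \<open>x\<close> and primed data for \<open>y\<close>. The new order compares zones first and
  then, within a zone, uses the old order, reversed if \<open>zone_flip\<close> holds.\<close>

lemma zone_table:
  assumes "b \<longrightarrow> a" "b' \<longrightarrow> a'" "a \<longrightarrow> \<not> a' \<longrightarrow> l" "\<not> a \<longrightarrow> a' \<longrightarrow> \<not> l" "b \<longrightarrow> \<not> b' \<longrightarrow> l" "\<not> b \<longrightarrow> b' \<longrightarrow> \<not> l"
  shows "of_bool (zone_pos p q a' b' < zone_pos p q a b \<or>
       zone_pos p q a' b' = zone_pos p q a b \<and> l \<noteq> zone_flip p r a b) =
     of_bool l + (p * of_bool a * of_bool a'
       + q * (of_bool a * of_bool b' + of_bool b * of_bool a') + r * of_bool b * of_bool b')"
  using assms
  by (cases a; cases b; cases a'; cases b'; cases l; simp;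
      cases p; cases q; cases r; simp add: zone_pos_def zone_flip_def)
lemma reorder_zones_le:
  fixes f :: "'a \<Rightarrow> nat" and p q r :: bit
  assumes "finite W" "s \<le> t"
  shows "\<exists>g :: 'a \<Rightarrow> nat. \<forall>x\<in>W. \<forall>y\<in>W. f x \<noteq> f y \<longrightarrow> g x \<noteq> g y \<and>
       of_bool (g y < g x) = of_bool (f y < f x) + (p * of_bool (s < f x) * of_bool (s < f y)
         + q * (of_bool (s < f x) * of_bool (t < f y) + of_bool (t < f x) * of_bool (s < f y))
         + r * of_bool (t < f x) * of_bool (t < f y))"
proof -
  obtain B where B: "\<And>x. x \<in> W \<Longrightarrow> f x < B"
    using assms(1) finite_nat_set_iff_bounded[of "f ` W"] by auto
  define z where "z x = zone_pos p q (s < f x) (t < f x)" for x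
  define flip where "flip x = zone_flip p r (s < f x) (t < f x)" for x
  define e where "e x = (if flip x then B - f x else f x)" for x
  \<comment> \<open>A lexicographic code, zone first. The factor is \<open>Suc B\<close> because a
    reversed value \<open>B - f x\<close> can equal \<open>B\<close>.\<close>
  define g where "g x = z x * Suc B + e x" for x
  have e: "e x < Suc B" if "x \<in> W" for x
    using B[OF that] by (auto simp: e_def)
  have less_if_zone_less: "g x < g y" if "z x < z y" "x \<in> W" for x y
  proof -
    have "Suc (z x) * Suc B \<le> z y * Suc B" using that(1) by (intro mult_le_mono) auto
    then show ?thesis using e[OF that(2)] unfolding g_def by simp
  qed
  have "g x \<noteq> g y \<and>
       of_bool (g y < g x) = of_bool (f y < f x) + (p * of_bool (s < f x) * of_bool (s < f y)
         + q * (of_bool (s < f x) * of_bool (t < f y) + of_bool (t < f x) * of_bool (s < f y))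
         + r * of_bool (t < f x) * of_bool (t < f y))"
    if xy: "x \<in> W" "y \<in> W" "f x \<noteq> f y" for x y
  proof -
    have same: "g x \<noteq> g y \<and> (g y < g x \<longleftrightarrow> (f y < f x) \<noteq> flip x)" if "z x = z y"
    proof -
      have "flip x = flip y"
        using zone_pos_eqD[OF that[unfolded z_def]] assms(2) by (simp add: flip_def)
      then show ?thesis
        using B[OF xy(1)] B[OF xy(2)] xy(3) that by (cases "flip x") (auto simp: g_def e_def)
    qed
    have "g x \<noteq> g y \<and> (g y < g x \<longleftrightarrow> z y < z x \<or> z y = z x \<and> (f y < f x) \<noteq> flip x)"
      using less_if_zone_less[of x y] less_if_zone_less[of y x] same xy(1,2)
      by (cases "z x" "z y" rule: linorder_cases) auto
    then show ?thesis
      using zone_table[of "t < f x" "s < f x" "t < f y" "s < f y" "f y < f x" p q r] assms(2)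
      unfolding z_def flip_def by auto
  qed
  then show ?thesis by blast
qed

lemma reorder_zones:
  fixes f :: "'a \<Rightarrow> nat" and p q r :: bit
  assumes "finite W"
  shows "\<exists>g :: 'a \<Rightarrow> nat. \<forall>x\<in>W. \<forall>y\<in>W. f x \<noteq> f y \<longrightarrow> g x \<noteq> g y \<and>
       of_bool (g y < g x) = of_bool (f y < f x) + (p * of_bool (s < f x) * of_bool (s < f y)
         + q * (of_bool (s < f x) * of_bool (t < f y) + of_bool (t < f x) * of_bool (s < f y))
         + r * of_bool (t < f x) * of_bool (t < f y))"
proof (cases "s \<le> t")
  case True
  then show ?thesis by (rule reorder_zones_le[OF assms])
next
  case False
  then have "t \<le> s" by simp
  \<comment> \<open>Exchanging the two thresholds exchanges \<open>p\<close> and \<open>r\<close>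
    and leaves the expression otherwise unchanged.\<close>
  from reorder_zones_le[OF assms this, of f r q p] show ?thesis
    by (simp add: ac_simps)
qed

subsection \<open>Joins\<close>

lemma pverts_njoin [simp]: "pverts (njoin n D) = (SIGMA i:{1..n}. pverts (D i))"
  by (simp add: njoin_def)

lemma parcs_njoin:
  "((a, u), (b, v)) \<in> parcs (njoin n D) \<longleftrightarrow> a \<in> {1..n} \<and> b \<in> {1..n} \<and>
     (a = b \<and> (u, v) \<in> parcs (D a) \<or> a < b \<and> u \<in> pverts (D a) \<and> v \<in> pverts (D b))"
  by (auto simp: njoin_def)

text \<open>Every earlier vertex \<open>x\<close> has an arc to \<open>a\<close> and to
  \<open>b\<close>, so \<open>M x a\<close> and \<open>M x b\<close> only record whether
  \<open>x\<close> lies above the thresholds \<open>f a\<close> and \<open>f b\<close>. Arbitrary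
  coefficients cover Schur complements of 1x1 and 2x2 minors alike.\<close>

lemma njoin_remove_last:
  assumes D: "oriented_graph (njoin n D)"
    and M: "\<And>x y. M x y = M y x" "ordered_by (parcs (njoin (Suc n) D)) M f"
    and uv: "u \<in> pverts (D (Suc n))" "v \<in> pverts (D (Suc n))"
  defines "a \<equiv> (Suc n, u)" and "b \<equiv> (Suc n, v)"
  shows "\<exists>g. ordered_by (parcs (njoin n D)) (\<lambda>x y. M x y + (p * M x a * M y a
       + q * (M x a * M y b + M x b * M y a) + r * M x b * M y b)) g"
proof -
  let ?W = "pverts (njoin n D)"
  have M_last: "M x (Suc n, w) = of_bool (f (Suc n, w) < f x)"
    if "x \<in> ?W" "w \<in> pverts (D (Suc n))" for x w
  proof -
    have "(x, (Suc n, w)) \<in> parcs (njoin (Suc n) D)"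
      using that by (cases x) (auto simp: parcs_njoin)
    then have "M x (Suc n, w) = of_bool (f (Suc n, w) < f x)"
      using M(2) unfolding ordered_by_def by blast
    then show ?thesis .
  qed
  have Ma: "M x a = of_bool (f a < f x)" and Mb: "M x b = of_bool (f b < f x)" if "x \<in> ?W" for x
    using M_last[OF that uv(1)] M_last[OF that uv(2)] by (simp_all add: a_def b_def)
  obtain g :: "nat \<times> 'a \<Rightarrow> nat" where g: "\<forall>x\<in>?W. \<forall>y\<in>?W. f x \<noteq> f y \<longrightarrow> g x \<noteq> g y \<and>
       of_bool (g y < g x) = of_bool (f y < f x) + (p * of_bool (f a < f x) * of_bool (f a < f y)
         + q * (of_bool (f a < f x) * of_bool (f b < f y) + of_bool (f b < f x) * of_bool (f a < f y))
         + r * of_bool (f b < f x) * of_bool (f b < f y))"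
    using reorder_zones[OF oriented_graphD(1)[OF D]] by blast
  have "ordered_by (parcs (njoin n D)) (\<lambda>x y. M x y + (p * M x a * M y a
       + q * (M x a * M y b + M x b * M y a) + r * M x b * M y b)) g"
    unfolding ordered_by_def
  proof (rule ballI, rule case_prodI2)
    fix e x y assume e: "e \<in> parcs (njoin n D)" "e = (x, y)"
    then have W: "x \<in> ?W" "y \<in> ?W"
      using oriented_graphD(3)[OF D] by auto
    have "(x, y) \<in> parcs (njoin (Suc n) D)"
      using e by (cases x; cases y) (auto simp: parcs_njoin)
    then have "f x \<noteq> f y" "M x y = of_bool (f y < f x)"
      using M(2) unfolding ordered_by_def by blast+
    moreover have "f x \<noteq> f y \<longrightarrow> g x \<noteq> g y \<and>
       of_bool (g y < g x) = of_bool (f y < f x) + (p * of_bool (f a < f x) * of_bool (f a < f y)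
         + q * (of_bool (f a < f x) * of_bool (f b < f y) + of_bool (f b < f x) * of_bool (f a < f y))
         + r * of_bool (f b < f x) * of_bool (f b < f y))"
      using g W by blast
    ultimately show "g x \<noteq> g y \<and> M x y + (p * M x a * M y a
       + q * (M x a * M y b + M x b * M y a) + r * M x b * M y b) = of_bool (g y < g x)"
      by (simp only: Ma[OF W(1)] Ma[OF W(2)] Mb[OF W(1)] Mb[OF W(2)]) simp
  qed
  then show ?thesis by blast
qed

text \<open>The induction runs over all symmetric matrices of bounded rank, since a Schur complement
  need not be the Gram matrix of as few sets as its rank: a nonzero one with zero diagonal never
  is.\<close>

lemma njoin_lower_bound:
  assumes "\<And>i. i \<in> {1..n} \<Longrightarrow> oriented_graph (D i)"
    and "\<And>i. i \<in> {1..n} \<Longrightarrow> inversion_number (D i) \<le> 2"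
    and "\<And>x y. M x y = M y x" "rank_le r M" "ordered_by (parcs (njoin n D)) M f"
  shows "(\<Sum>i = 1..n. inversion_number (D i)) \<le> r"
  using assms
proof (induction n arbitrary: M r f)
  case (Suc n)
  let ?k = "Suc n"
  let ?V = "pverts (D ?k)"
  note sym = Suc.prems(3)
  have Dk: "oriented_graph (D ?k)" and inv2: "inversion_number (D ?k) \<le> 2"
    using Suc.prems(1,2) by simp_all
  have J: "oriented_graph (njoin n D)"
    by (rule oriented_graph_njoin) (simp add: Suc.prems(1))
  define M' where "M' u v = M (?k, u) (?k, v)" for u v
  have M': "ordered_by (parcs (D ?k)) M' (\<lambda>u. f (?k, u))"
    unfolding ordered_by_def M'_def
  proof (rule ballI, rule case_prodI2)
    fix e u v assume "e \<in> parcs (D ?k)" "e = (u, v)"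
    then have "((?k, u), (?k, v)) \<in> parcs (njoin ?k D)" by (simp add: parcs_njoin)
    then show "f (?k, u) \<noteq> f (?k, v) \<and> M (?k, u) (?k, v) = of_bool (f (?k, v) < f (?k, u))"
      using Suc.prems(5) unfolding ordered_by_def by blast
  qed
  have IH: ?case
    if "rank_le s N" "\<And>x y. N x y = N y x" "ordered_by (parcs (njoin n D)) N g"
      and "s + inversion_number (D ?k) \<le> r" for s N g
  proof -
    have "(\<Sum>i = 1..n. inversion_number (D i)) \<le> s"
      by (rule Suc.IH[of N s g, OF _ _ that(2,1,3)]) (simp_all add: Suc.prems(1,2))
    then show ?thesis using that(4) by simp
  qed
  \<comment> \<open>The cases overlap: whenever a nonsingular pair exists, the rank drop of 2
    suffices by \<open>inv2\<close>. Without one, \<open>M'\<close> is the product of its diagonal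
    entries, so the inversion number is at most 1, and 0 if the diagonal vanishes.\<close>
  consider (zero) "inversion_number (D ?k) = 0"
    | (pair) u v where "u \<in> ?V" "v \<in> ?V" "M' u v \<noteq> M' u u * M' v v"
    | (one) u where "inversion_number (D ?k) = 1" "u \<in> ?V" "M' u u = 1"
  proof -
    assume h: "inversion_number (D ?k) = 0 \<Longrightarrow> thesis"
      "\<And>u v. u \<in> ?V \<Longrightarrow> v \<in> ?V \<Longrightarrow> M' u v \<noteq> M' u u * M' v v \<Longrightarrow> thesis"
      "\<And>u. inversion_number (D ?k) = 1 \<Longrightarrow> u \<in> ?V \<Longrightarrow> M' u u = 1 \<Longrightarrow> thesis"
    show thesis
    proof (cases "\<exists>u\<in>?V. \<exists>v\<in>?V. M' u v \<noteq> M' u u * M' v v")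
      case False
      then have prod: "M' u v = M' u u * M' v v" if "u \<in> ?V" "v \<in> ?V" for u v
        using that by blast
      have le1: "inversion_number (D ?k) \<le> 1"
        by (rule inversion_number_le_1I[OF Dk M' prod])
      show thesis
      proof (cases "\<exists>u\<in>?V. M' u u = 1")
        case True
        then obtain u where u: "u \<in> ?V" "M' u u = 1" by blast
        from le1 consider "inversion_number (D ?k) = 0" | "inversion_number (D ?k) = 1" by linarith
        then show thesis
        proof cases
          case 1
          then show thesis by (rule h(1))
        next
          case 2
          then show thesis using u by (rule h(3))
        qed
      next
        case False
        then have "M' u v = 0" if "u \<in> ?V" "v \<in> ?V" for u v
          using prod[OF that] that by (cases "M' u u") auto
        then show thesis by (rule h(1)[OF inversion_number_eq_0I[OF Dk M']])
      qed
    next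
      case True
      then obtain u v where "u \<in> ?V" "v \<in> ?V" "M' u v \<noteq> M' u u * M' v v" by blast
      then show thesis by (rule h(2))
    qed
  qed
  then show ?case
  proof cases
    case zero
    have "ordered_by (parcs (njoin n D)) M f"
    proof -
      have "parcs (njoin n D) \<subseteq> parcs (njoin ?k D)"
        by (fastforce simp: njoin_def)
      then show ?thesis using Suc.prems(5) unfolding ordered_by_def by blast
    qed
    then show ?thesis by (rule IH[of r M f, OF Suc.prems(4) sym]) (simp add: zero)
  next
    case (pair u v)
    let ?N = "\<lambda>x y. M x y + (M (?k, v) (?k, v) * M x (?k, u) * M y (?k, u)
       + M (?k, u) (?k, v) * (M x (?k, u) * M y (?k, v) + M x (?k, v) * M y (?k, u))
       + M (?k, u) (?k, u) * M x (?k, v) * M y (?k, v))"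
    note N = rank_le_reduce_pair[of r M "(?k, u)" "(?k, v)", OF Suc.prems(4) sym pair(3)[unfolded M'_def]]
    obtain g where "ordered_by (parcs (njoin n D)) ?N g"
      using njoin_remove_last[of n D M f u v, OF J sym Suc.prems(5) pair(1,2)] by blast
    then show ?thesis
    proof (rule IH[of "r - 2" ?N g, OF N(2), rotated])
      show "?N x y = ?N y x" for x y
        by (simp add: sym[of x y] ac_simps)
    qed (use N(1) inv2 in linarith)
  next
    case (one u)
    let ?N = "\<lambda>x y. M x y + M x (?k, u) * M y (?k, u)"
    have "M (?k, u) (?k, u) = 1" using one(3) by (simp add: M'_def)
    then have N: "r > 0" "rank_le (r - 1) (\<lambda>x y. M x y + M x (?k, u) * M (?k, u) y)"
      using rank_le_reduce[of r M "(?k, u)" "(?k, u)", OF Suc.prems(4)] by (simp_all add: reduce_def[abs_def])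
    have N_eq: "(\<lambda>x y. M x y + M x (?k, u) * M (?k, u) y) = ?N"
      by (intro ext arg_cong2[where f = "(+)"] arg_cong2[where f = "(*)"] refl sym)
    obtain g where "ordered_by (parcs (njoin n D)) ?N g"
      \<comment> \<open>The 1x1 Schur complement: both thresholds sit at \<open>u\<close>, and only
        the coefficient \<open>p\<close> is nonzero.\<close>
      using njoin_remove_last[of n D M f u u 1 0 0, OF J sym Suc.prems(5) one(2,2)] by auto
    then show ?thesis
    proof (rule IH[of "r - 1" ?N g, OF N(2)[unfolded N_eq], rotated])
      show "?N x y = ?N y x" for x y
        by (simp add: sym[of x y] ac_simps)
    qed (use N(1) one(1) in linarith)
  qed
next
  case 0
  show ?case by simp
qed

section \<open>Upper bound by combining families\<close>

lemma gram_eq_0: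
  assumes "\<And>X. X \<in> set Xs \<Longrightarrow> X \<subseteq> V" "u \<notin> V \<or> v \<notin> V"
  shows "gram Xs u v = 0"
  using assms by (induction Xs) auto

lemma gram_map_Pair:
  "gram (map ((`) (Pair k)) Xs) (a, u) (b, v) = of_bool (a = k \<and> b = k) * gram Xs u v"
  by (induction Xs) (auto simp: image_iff)

text \<open>Optimal families of the single graphs are concatenated. Each set stays inside one graph,
  so arcs between different graphs are never reversed and the orders can be stacked.\<close>

lemma njoin_upper_bound:
  assumes "\<And>i. i \<in> {1..n} \<Longrightarrow> oriented_graph (D i)"
  shows "\<exists>Xs. decycling_family (njoin n D) Xs \<and> length Xs = (\<Sum>i = 1..n. inversion_number (D i))"
  using assms
proof (induction n)
  case 0
  have "decycling_family (njoin 0 D) []"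
    using decycling_family_iff[OF oriented_graph_njoin[of 0 D]]
    by (auto simp: ordered_by_def njoin_def)
  then show ?case by auto
next
  case (Suc n)
  let ?k = "Suc n"
  let ?W = "pverts (njoin n D)"
  have Dk: "oriented_graph (D ?k)" using Suc.prems by simp
  have J: "oriented_graph (njoin n D)" and J': "oriented_graph (njoin ?k D)"
    by (rule oriented_graph_njoin, simp add: Suc.prems)+
  obtain Xs where Xs: "decycling_family (njoin n D) Xs"
    "length Xs = (\<Sum>i = 1..n. inversion_number (D i))"
    using Suc by auto
  obtain Ys where Ys: "decycling_family (D ?k) Ys" "length Ys = inversion_number (D ?k)"
    using inversion_number_attained[OF Dk] .
  obtain f where f: "ordered_by (parcs (njoin n D)) (gram Xs) f" and Xs_sub: "\<forall>X\<in>set Xs. X \<subseteq> ?W"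
    using Xs(1) decycling_family_iff[OF J] by blast
  obtain g where g: "ordered_by (parcs (D ?k)) (gram Ys) g" and Ys_sub: "\<forall>X\<in>set Ys. X \<subseteq> pverts (D ?k)"
    using Ys(1) decycling_family_iff[OF Dk] by blast
  obtain B where B: "\<And>x. x \<in> ?W \<Longrightarrow> f x < B"
    using oriented_graphD(1)[OF J] finite_nat_set_iff_bounded[of "f ` ?W"] by auto
  \<comment> \<open>The shift by \<open>B\<close> puts the last graph above all earlier
    vertices.\<close>
  define h where "h = (\<lambda>(a, u). if a = ?k then B + g u else f (a, u))"
  let ?Zs = "Xs @ map ((`) (Pair ?k)) Ys"
  have gram: "gram ?Zs (a, u) (b, v) = (if a = ?k \<and> b = ?k then gram Ys u v else gram Xs (a, u) (b, v))"
    for a b u v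
    using gram_eq_0[of Xs ?W "(a, u)" "(b, v)"] Xs_sub by (auto simp: gram_append gram_map_Pair)
  have "h (a, u) \<noteq> h (b, v) \<and> gram ?Zs (a, u) (b, v) = of_bool (h (b, v) < h (a, u))"
    if arc: "((a, u), (b, v)) \<in> parcs (njoin ?k D)" for a b u v
  proof -
    consider "a = ?k" "b = ?k" "(u, v) \<in> parcs (D ?k)"
      | "a \<noteq> ?k" "b = ?k" "(a, u) \<in> ?W"
      | "a \<noteq> ?k" "b \<noteq> ?k" "((a, u), (b, v)) \<in> parcs (njoin n D)"
      using arc by (cases "a = ?k"; cases "b = ?k") (auto simp: parcs_njoin)
    then show ?thesis
    proof cases
      case 1
      then show ?thesis using g by (auto simp: gram h_def ordered_by_def)
    next
      case 2
      have "gram Xs (a, u) (b, v) = 0"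
        using 2(2) Xs_sub by (intro gram_eq_0[of _ ?W]) auto
      then show ?thesis using 2 B[OF 2(3)] by (simp add: gram h_def)
    next
      case 3
      then show ?thesis using f by (auto simp: gram h_def ordered_by_def)
    qed
  qed
  then have "ordered_by (parcs (njoin ?k D)) (gram ?Zs) h"
    unfolding ordered_by_def by auto
  moreover have "\<forall>X\<in>set ?Zs. X \<subseteq> pverts (njoin ?k D)"
    using Xs_sub Ys_sub by fastforce
  ultimately have "decycling_family (njoin ?k D) ?Zs"
    using decycling_family_iff[OF J'] by blast
  moreover have "length ?Zs = (\<Sum>i = 1..?k. inversion_number (D i))"
    by (simp add: Xs(2) Ys(2))
  ultimately show ?case by blast
qed

theorem mainTheorem3:
  fixes n :: nat and D :: "nat \<Rightarrow> 'a pair_pre_digraph"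
  assumes "n \<ge> 1"
    and "\<And>i. i \<in> {1..n} \<Longrightarrow> oriented_graph (D i)"
    and "\<And>i. i \<in> {1..n} \<Longrightarrow> inversion_number (D i) \<le> 2"
  shows "inversion_number (njoin n D) = (\<Sum>i = 1..n. inversion_number (D i))"
proof (rule antisym)
  obtain Ys where "decycling_family (njoin n D) Ys"
    "length Ys = (\<Sum>i = 1..n. inversion_number (D i))"
    using njoin_upper_bound[of n D, OF assms(2)] by blast
  then show "inversion_number (njoin n D) \<le> (\<Sum>i = 1..n. inversion_number (D i))"
    using inversion_number_le[of "njoin n D" Ys] by simp
  have J: "oriented_graph (njoin n D)"
    using assms(2) by (rule oriented_graph_njoin)
  obtain Xs where Xs: "decycling_family (njoin n D) Xs" "length Xs = inversion_number (njoin n D)"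
    using inversion_number_attained[OF J] by blast
  then obtain f where "ordered_by (parcs (njoin n D)) (gram Xs) f"
    using decycling_family_iff[OF J] by blast
  \<comment> \<open>The Gram matrix of an optimal family of the join has rank at most its number of
    sets.\<close>
  from njoin_lower_bound[of n D "gram Xs" "length Xs" f, OF assms(2,3) gram_commute rank_le_gram this]
  show "(\<Sum>i = 1..n. inversion_number (D i)) \<le> inversion_number (njoin n D)"
    unfolding Xs(2) by blast
qed

end
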